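(* Let $\alpha>-1$ be real and let $\langle f,g\rangle=\int_0^{+\infty} f(x)g(x)\,x^{\alpha}e^{-x}\,dx$ on real polynomials. Let $l_0^\alpha,l_1^\alpha,l_2^\alpha,\dots$ be the orthogonal sequence produced by the Gram-Schmidt process (without normalization) from the monomials $1,x,x^2,\dots$ with respect to this inner product. Then for every integer $n\ge 0$, $$l_n^{\alpha}(x)=(-1)^n\,n!\,L_n^{\alpha}(x).$$
   Context: The Gram-Schmidt process applied to linearly independent vectors $v_0,v_1,\dots$ produces $u_k=v_k-\sum_{i=0}^{k-1}\frac{\langle v_k,u_i\rangle}{\langle u_i,u_i\rangle}u_i$ for $k\ge 0$ (so $u_0=v_0$, and the coefficient of $v_k$ in $u_k$ is $1$). The Pochhammer symbol is $(a)_n=a(a+1)\cdots(a+n-1)$, with $(a)_0=1$. The Laguerre polynomials are defined by the explicit expression $$L_n^\alpha(x)=\sum_{m=0}^n(-1)^m\frac{(\alpha+1)_n}{m!\,(n-m)!\,(\alpha+1)_m}x^m .$$ *)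

theory Defs
  imports "HOL-Analysis.Analysis" "HOL-Computational_Algebra.Polynomial"
begin

text \<open>
  The Bochner integral is by convention 0 for a non-integrable integrand; for
  \<open>\<alpha> > -1\<close> the integrand below is integrable for all polynomials \<open>f\<close>, \<open>g\<close>.
  The null set \<open>{0}\<close> is left out because \<open>0 powr \<alpha> = 0\<close> in HOL.
\<close>

definition laguerre_inner :: "real \<Rightarrow> real poly \<Rightarrow> real poly \<Rightarrow> real" where
  "laguerre_inner \<alpha> f g =
     (LINT x:{0<..}|lborel. poly f x * poly g x * x powr \<alpha> * exp (- x))"

fun gram_schmidt_seq ::
  "(real poly \<Rightarrow> real poly \<Rightarrow> real) \<Rightarrow> (nat \<Rightarrow> real poly) \<Rightarrow> nat \<Rightarrow> real poly" where
  "gram_schmidt_seq ip v k =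
     v k - (\<Sum>i<k. smult (ip (v k) (gram_schmidt_seq ip v i)
                        / ip (gram_schmidt_seq ip v i) (gram_schmidt_seq ip v i))
                       (gram_schmidt_seq ip v i))"

text \<open>The defining equation rewrites indefinitely when used by the simplifier.\<close>

declare gram_schmidt_seq.simps [simp del]

definition laguerre_gram_schmidt :: "real \<Rightarrow> nat \<Rightarrow> real poly" where
  "laguerre_gram_schmidt \<alpha> = gram_schmidt_seq (laguerre_inner \<alpha>) (\<lambda>k. monom 1 k)"

definition laguerre_poly :: "nat \<Rightarrow> real \<Rightarrow> real poly" where
  "laguerre_poly n \<alpha> =
     (\<Sum>m=0..n. monom ((-1) ^ m * pochhammer (\<alpha> + 1) n
                       / (fact m * fact (n - m) * pochhammer (\<alpha> + 1) m)) m)"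

end

theory Submission
  imports Defs
begin

text \<open>
  Write \<open>A = \<alpha> + 1\<close> and \<open>p\<^sub>n = (-1)\<^sup>n n! L\<^sub>n\<close>. The result of the Gram-Schmidt process is
  determined by two properties: it is orthogonal, and it arises from the input by a
  unitriangular change of basis (\<open>gram_schmidt_seq_eqI\<close>). Starting from the monomials, the
  second property holds for every monic sequence with one polynomial in each degree
  (\<open>monic_sequence_spans\<close>), so what matters is that the \<open>p\<^sub>n\<close> are pairwise orthogonal and have
  non-zero norm.

  The moments of the weight \<open>x powr \<alpha> * exp (- x)\<close> are \<open>\<Gamma>(A + k) = \<Gamma>(A) (A)\<^sub>k\<close>. Pairing
  \<open>p\<^sub>n\<close> with \<open>x\<^sup>j\<close>, the factor \<open>(A)\<^sub>m\<close> in the denominator of the coefficient of \<open>x\<^sup>m\<close>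
  turns the moment \<open>(A)\<^bsub>m+j\<^esub>\<close> into \<open>(A + m)\<^sub>j\<close>. Up to a constant, the pairing is thus
  \<open>\<Sum>m\<le>n. (-1)\<^sup>m (n choose m) (A + m)\<^sub>j\<close>, an \<open>n\<close>-th finite difference of a polynomial of
  degree \<open>j\<close> in \<open>m\<close>. It vanishes for \<open>j < n\<close>, which is orthogonality, and for \<open>j = n\<close> it is
  \<open>(-1)\<^sup>n n!\<close>, which makes the squared norm of \<open>p\<^sub>n\<close> equal to \<open>n! \<Gamma>(A) (A)\<^sub>n > 0\<close>.
\<close>

section \<open>Gram-Schmidt orthogonalization\<close>

text \<open>
  Pairing the triangular relation for \<open>v k\<close> with \<open>p j\<close> isolates the coefficient \<open>c j\<close>. The
  coefficients are therefore the projection coefficients that the process subtracts.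
\<close>

lemma gram_schmidt_seq_eqI:
  fixes ip :: "real poly \<Rightarrow> real poly \<Rightarrow> real" and p v :: "nat \<Rightarrow> real poly"
  assumes add: "\<And>f g h. ip (f + g) h = ip f h + ip g h"
    and scale: "\<And>a f h. ip (smult a f) h = a * ip f h"
    and orth: "\<And>i j. i \<noteq> j \<Longrightarrow> ip (p i) (p j) = 0"
    and norm: "\<And>i. ip (p i) (p i) \<noteq> 0"
    and triangular: "\<And>k. \<exists>c. v k = p k + (\<Sum>i<k. smult (c i) (p i))"
  shows "gram_schmidt_seq ip v k = p k"
proof (induction k rule: less_induct)
  case (less k)
  have zero: "ip 0 h = 0" for h
    using scale[of 0 0 h] by simp
  have ip_sum: "ip (sum f I) h = (\<Sum>i\<in>I. ip (f i) h)" for f :: "nat \<Rightarrow> real poly" and I h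
    by (induction I rule: infinite_finite_induct) (simp_all add: zero add)
  obtain c where c: "v k = p k + (\<Sum>i<k. smult (c i) (p i))"
    using triangular by blast
  have coeff: "ip (v k) (p j) / ip (p j) (p j) = c j" if "j < k" for j
  proof -
    have "ip (v k) (p j) = (\<Sum>i<k. c i * ip (p i) (p j))"
      using that by (simp add: c add ip_sum scale orth)
    also have "\<dots> = (\<Sum>i<k. if i = j then c j * ip (p j) (p j) else 0)"
      by (intro sum.cong) (auto simp: orth)
    also have "\<dots> = c j * ip (p j) (p j)"
      using that by simp
    finally show ?thesis
      using norm by simp
  qed
  have "gram_schmidt_seq ip v k
      = v k - (\<Sum>i<k. smult (ip (v k) (p i) / ip (p i) (p i)) (p i))"
    by (subst gram_schmidt_seq.simps) (simp add: less.IH)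
  also have "\<dots> = v k - (\<Sum>i<k. smult (c i) (p i))"
    by (simp add: coeff)
  also have "\<dots> = p k"
    by (simp add: c)
  finally show ?case .
qed

text \<open>
  Subtracting \<open>smult (coeff q k) (p k)\<close> removes the coefficient of \<open>q\<close> at \<open>k\<close> and leaves the
  higher ones zero. The hypothesis on \<open>q\<close> speaks of coefficients rather than
  \<open>degree q < k\<close> so that it includes \<open>q = 0\<close> at \<open>k = 0\<close>.
\<close>

lemma monic_sequence_spans:
  fixes p :: "nat \<Rightarrow> 'a::comm_ring_1 poly"
  assumes deg: "\<And>i. degree (p i) \<le> i" and monic: "\<And>i. coeff (p i) i = 1"
    and q: "\<And>j. j \<ge> k \<Longrightarrow> coeff q j = 0"
  shows "\<exists>c. q = (\<Sum>i<k. smult (c i) (p i))"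
  using q
proof (induction k arbitrary: q)
  case 0
  then show ?case by (simp add: poly_eq_iff)
next
  case (Suc k)
  define r where "r = q - smult (coeff q k) (p k)"
  have "coeff r j = 0" if "j \<ge> k" for j
  proof (cases "j = k")
    case False
    then have "coeff (p k) j = 0"
      using that deg[of k] by (intro coeff_eq_0) linarith
    then show ?thesis
      using False that Suc.prems by (simp add: r_def)
  qed (simp add: r_def monic)
  then obtain c where c: "r = (\<Sum>i<k. smult (c i) (p i))"
    using Suc.IH by blast
  have "q = (\<Sum>i<Suc k. smult ((c(k := coeff q k)) i) (p i))"
    using c by (simp add: r_def algebra_simps)
  then show ?case by blast
qed

section \<open>Finite differences of rising factorials\<close>

text \<open>
  Both sides are \<open>(-1)\<^bsup>n+1\<^esup> \<Delta>\<^bsup>n+1\<^esup> f(0)\<close>, where \<open>\<Delta>f(m) = f(m + 1) - f(m)\<close>. Pascal's rule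
  splits off one difference.
\<close>

lemma alternating_binomial_sum_Suc:
  fixes f :: "nat \<Rightarrow> 'a::comm_ring_1"
  shows "(\<Sum>m\<le>Suc n. (-1) ^ m * of_nat (Suc n choose m) * f m)
       = (\<Sum>m\<le>n. (-1) ^ m * of_nat (n choose m) * (f m - f (Suc m)))"
proof -
  have "(\<Sum>m\<le>Suc n. (-1) ^ m * of_nat (Suc n choose m) * f m)
      = f 0 + (\<Sum>m\<le>n. (-1) ^ Suc m * of_nat (n choose Suc m) * f (Suc m))
            - (\<Sum>m\<le>n. (-1) ^ m * of_nat (n choose m) * f (Suc m))"
    by (subst sum.atMost_Suc_shift) (simp add: algebra_simps sum.distrib sum_subtractf sum_negf)
  also have "f 0 + (\<Sum>m\<le>n. (-1) ^ Suc m * of_nat (n choose Suc m) * f (Suc m))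
      = (\<Sum>m\<le>Suc n. (-1) ^ m * of_nat (n choose m) * f m)"
    by (subst sum.atMost_Suc_shift) simp
  also have "\<dots> = (\<Sum>m\<le>n. (-1) ^ m * of_nat (n choose m) * f m)"
    by (simp add: binomial_eq_0)
  finally show ?thesis
    by (simp only: right_diff_distrib sum_subtractf)
qed

text \<open>
  Rising factorials behave under differences like powers under derivatives:
  \<open>(x)\<^sub>j - (x + 1)\<^sub>j = - j (x + 1)\<^bsub>j-1\<^esub>\<close>. Applying this \<open>n\<close> times yields the closed form. For
  \<open>j < n\<close>, where the subtraction \<open>j - n\<close> truncates, the factor \<open>j choose n\<close> is zero.
\<close>

lemma alternating_binomial_sum_pochhammer:
  fixes a :: "'a::{comm_ring_1,semiring_char_0}"
  shows "(\<Sum>m\<le>n. (-1) ^ m * of_nat (n choose m) * pochhammer (a + of_nat m) j)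
       = (-1) ^ n * fact n * of_nat (j choose n) * pochhammer (a + of_nat n) (j - n)"
proof (induction n arbitrary: a j)
  case (Suc n)
  show ?case
  proof (cases j)
    case 0
    then show ?thesis
      by (subst alternating_binomial_sum_Suc) simp
  next
    case (Suc i)
    have "pochhammer x (Suc i) - pochhammer (x + 1) (Suc i)
        = - of_nat (Suc i) * pochhammer (x + 1) i" for x :: 'a
      unfolding pochhammer_rec[of x] pochhammer_Suc[of "x + 1"] by (simp add: algebra_simps)
    from this[of "a + of_nat _"]
    have diff: "pochhammer (a + of_nat m) (Suc i) - pochhammer (a + of_nat (Suc m)) (Suc i)
        = - of_nat (Suc i) * pochhammer (a + of_nat m + 1) i" for m
      by (simp add: ac_simps)
    have "(\<Sum>m\<le>Suc n. (-1) ^ m * of_nat (Suc n choose m) * pochhammer (a + of_nat m) j)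
        = (\<Sum>m\<le>n. (-1) ^ m * of_nat (n choose m)
             * (- of_nat (Suc i) * pochhammer (a + of_nat m + 1) i))"
      unfolding alternating_binomial_sum_Suc Suc
      by (simp only: diff)
    also have "\<dots> = - of_nat (Suc i)
        * (\<Sum>m\<le>n. (-1) ^ m * of_nat (n choose m) * pochhammer ((a + 1) + of_nat m) i)"
      by (simp only: sum_distrib_left ac_simps)
    also have "\<dots> = - of_nat (Suc i) * ((-1) ^ n * fact n * of_nat (i choose n)
        * pochhammer (a + 1 + of_nat n) (i - n))"
      by (simp only: Suc.IH)
    also have "\<dots> = - ((-1) ^ n) * fact n * of_nat (Suc i * (i choose n))
        * pochhammer (a + 1 + of_nat n) (i - n)"
      by (simp only: of_nat_mult) (simp add: algebra_simps)
    also have "Suc i * (i choose n) = Suc n * (Suc i choose Suc n)"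
      by (rule Suc_times_binomial[symmetric])
    also have "- ((-1) ^ n) * fact n * of_nat (Suc n * (Suc i choose Suc n))
        * pochhammer (a + 1 + of_nat n) (i - n)
      = (-1) ^ Suc n * fact (Suc n) * of_nat (j choose Suc n)
        * pochhammer (a + of_nat (Suc n)) (j - Suc n)"
      unfolding Suc of_nat_mult fact_Suc by (simp add: ac_simps)
    finally show ?thesis .
  qed
qed simp

section \<open>The Laguerre inner product\<close>

text \<open>
  This is Euler's integral for \<open>\<Gamma>\<close>. Stating it as a Bochner integral records
  integrability of the weighted monomials together with the value.
\<close>

lemma laguerre_moment:
  fixes \<alpha> :: real
  assumes "\<alpha> > -1"
  shows "has_bochner_integral lborel
           (\<lambda>x. indicator {0<..} x *\<^sub>R (x ^ k * x powr \<alpha> * exp (- x)))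
           (Gamma (\<alpha> + 1 + of_nat k))"
proof -
  define s where "s = \<alpha> + 1 + real k"
  have s: "s > 0"
    using assms by (simp add: s_def)
  have "indicator {0..} x * x powr (s - 1) / exp x
      = indicator {0<..} x *\<^sub>R (x ^ k * x powr \<alpha> * exp (- x))" for x :: real
  proof (cases "x > 0")
    case True
    then show ?thesis
      by (simp add: s_def powr_add powr_realpow exp_minus field_simps)
  qed (cases "x = 0", auto)
  then have "(\<integral>\<^sup>+x. ennreal (indicator {0<..} x *\<^sub>R (x ^ k * x powr \<alpha> * exp (- x))) \<partial>lborel)
      = ennreal (Gamma s)"
    using Gamma_conv_nn_integral_real[OF s] by simp
  moreover have "Gamma s \<ge> 0"
    using s by (simp add: Gamma_real_pos less_imp_le)
  ultimately show ?thesis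
    unfolding s_def by (intro has_bochner_integral_nn_integral) (auto simp: indicator_def)
qed

lemma set_integrable_laguerre_weight:
  fixes \<alpha> :: real
  assumes "\<alpha> > -1"
  shows "set_integrable lborel {0<..} (\<lambda>x. poly f x * poly g x * x powr \<alpha> * exp (- x))"
proof -
  have "set_integrable lborel {0<..} (\<lambda>x. x ^ i * x powr \<alpha> * exp (- x))" for i
    using laguerre_moment[OF assms]
    unfolding set_integrable_def by (auto simp: has_bochner_integral_iff)
  then have "set_integrable lborel {0<..} (\<lambda>x. coeff (f * g) i * (x ^ i * x powr \<alpha> * exp (- x)))"
    for i
    by (intro set_integrable_mult_right)
  then have "set_integrable lborel {0<..}
      (\<lambda>x. \<Sum>i\<le>degree (f * g). coeff (f * g) i * (x ^ i * x powr \<alpha> * exp (- x)))"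
    unfolding set_integrable_def scaleR_sum_right
    by (intro Bochner_Integration.integrable_sum)
  also have "(\<lambda>x. \<Sum>i\<le>degree (f * g). coeff (f * g) i * (x ^ i * x powr \<alpha> * exp (- x)))
      = (\<lambda>x. poly (f * g) x * x powr \<alpha> * exp (- x))"
    by (simp add: poly_altdef sum_distrib_right mult.assoc)
  finally show ?thesis
    by simp
qed

lemma laguerre_inner_commute: "laguerre_inner \<alpha> f g = laguerre_inner \<alpha> g f"
  by (simp add: laguerre_inner_def mult.commute)

lemma laguerre_inner_add:
  assumes "\<alpha> > -1"
  shows "laguerre_inner \<alpha> (f + g) h = laguerre_inner \<alpha> f h + laguerre_inner \<alpha> g h"
  using set_integral_add(2)[OF set_integrable_laguerre_weight[OF assms, of f h]
      set_integrable_laguerre_weight[OF assms, of g h]]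
  by (simp add: laguerre_inner_def algebra_simps)

lemma laguerre_inner_smult: "laguerre_inner \<alpha> (smult a f) h = a * laguerre_inner \<alpha> f h"
  by (simp add: laguerre_inner_def mult.assoc)

lemma laguerre_inner_sum:
  assumes "\<alpha> > -1"
  shows "laguerre_inner \<alpha> (\<Sum>i\<in>I. smult (c i) (f i)) h = (\<Sum>i\<in>I. c i * laguerre_inner \<alpha> (f i) h)"
proof -
  have "laguerre_inner \<alpha> 0 h = 0"
    by (simp add: laguerre_inner_def)
  then show ?thesis
    by (induction I rule: infinite_finite_induct)
      (simp_all add: laguerre_inner_add[OF assms] laguerre_inner_smult)
qed

lemma laguerre_inner_monom:
  assumes "\<alpha> > -1"
  shows "laguerre_inner \<alpha> (monom 1 i) (monom 1 j)
       = Gamma (\<alpha> + 1) * pochhammer (\<alpha> + 1) (i + j)"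
proof -
  have pos: "\<alpha> + 1 > 0"
    using assms by simp
  then have "\<alpha> + 1 \<notin> \<int>\<^sub>\<le>\<^sub>0"
    by (auto dest: nonpos_Ints_nonpos)
  moreover have "Gamma (\<alpha> + 1) \<noteq> 0"
    using Gamma_real_pos[OF pos] by simp
  moreover have "laguerre_inner \<alpha> (monom 1 i) (monom 1 j) = Gamma (\<alpha> + 1 + of_nat (i + j))"
    using has_bochner_integral_integral_eq[OF laguerre_moment[OF assms, of "i + j"]]
    by (simp add: laguerre_inner_def set_lebesgue_integral_def poly_monom power_add)
  ultimately show ?thesis
    by (simp add: pochhammer_Gamma)
qed

section \<open>Orthogonality of the Laguerre polynomials\<close>

definition monic_laguerre :: "real \<Rightarrow> nat \<Rightarrow> real poly" where
  "monic_laguerre \<alpha> n = smult ((-1) ^ n * fact n) (laguerre_poly n \<alpha>)"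

lemma coeff_laguerre_poly:
  "coeff (laguerre_poly n \<alpha>) m =
     (if m \<le> n then (-1) ^ m * pochhammer (\<alpha> + 1) n
                    / (fact m * fact (n - m) * pochhammer (\<alpha> + 1) m) else 0)"
  by (simp add: laguerre_poly_def coeff_sum)

lemma degree_monic_laguerre: "degree (monic_laguerre \<alpha> n) \<le> n"
  by (intro degree_le) (simp add: monic_laguerre_def coeff_laguerre_poly)

lemma lead_coeff_monic_laguerre:
  assumes "\<alpha> > -1"
  shows "coeff (monic_laguerre \<alpha> n) n = 1"
  using pochhammer_pos[of "\<alpha> + 1" n] assms
  by (simp add: monic_laguerre_def coeff_laguerre_poly flip: power_mult_distrib)

text \<open>
  The identity \<open>(A)\<^bsub>m+j\<^esub> = (A)\<^sub>m (A + m)\<^sub>j\<close> cancels the \<open>(A)\<^sub>m\<close> in the denominator of the \<open>m\<close>-th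
  Laguerre coefficient, and the factorials combine to \<open>n choose m\<close>. What remains is the
  alternating sum evaluated above.
\<close>

lemma laguerre_inner_monic_laguerre_monom:
  assumes "\<alpha> > -1"
  shows "laguerre_inner \<alpha> (monic_laguerre \<alpha> n) (monom 1 j)
       = Gamma (\<alpha> + 1) * pochhammer (\<alpha> + 1) n * fact n * of_nat (j choose n)
         * pochhammer (\<alpha> + 1 + of_nat n) (j - n)"
proof -
  define A where "A = \<alpha> + 1"
  have nz: "pochhammer A m \<noteq> 0" for m
    using pochhammer_pos[of A m] assms by (simp add: A_def)
  have "monic_laguerre \<alpha> n = (\<Sum>m\<le>n. smult (coeff (monic_laguerre \<alpha> n) m) (monom 1 m))"
    using poly_as_sum_of_monoms'[OF degree_monic_laguerre, of \<alpha> n] by (simp add: smult_monom)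
  then have "laguerre_inner \<alpha> (monic_laguerre \<alpha> n) (monom 1 j)
      = (\<Sum>m\<le>n. coeff (monic_laguerre \<alpha> n) m * laguerre_inner \<alpha> (monom 1 m) (monom 1 j))"
    using laguerre_inner_sum[OF assms] by metis
  also have "\<dots> = (\<Sum>m\<le>n. (-1) ^ n * Gamma A * pochhammer A n *
      ((-1) ^ m * of_nat (n choose m) * pochhammer (A + of_nat m) j))"
  proof (intro sum.cong refl)
    fix m assume "m \<in> {..n}"
    then show "coeff (monic_laguerre \<alpha> n) m * laguerre_inner \<alpha> (monom 1 m) (monom 1 j)
        = (-1) ^ n * Gamma A * pochhammer A n *
          ((-1) ^ m * of_nat (n choose m) * pochhammer (A + of_nat m) j)"
      using nz[of m]
      by (simp add: laguerre_inner_monom[OF assms] monic_laguerre_def coeff_laguerre_poly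
          binomial_fact pochhammer_product' flip: A_def)
  qed
  also have "\<dots> = (-1) ^ n * Gamma A * pochhammer A n *
      ((-1) ^ n * fact n * of_nat (j choose n) * pochhammer (A + of_nat n) (j - n))"
    by (simp only: sum_distrib_left[symmetric] alternating_binomial_sum_pochhammer)
  also have "\<dots> = ((-1) ^ n * (-1) ^ n) * (Gamma A * pochhammer A n * fact n
      * of_nat (j choose n) * pochhammer (A + of_nat n) (j - n))"
    by (simp only: ac_simps)
  finally show ?thesis
    by (simp add: A_def flip: power_mult_distrib)
qed

text \<open>
  All monomials of \<open>q\<close> below degree \<open>n\<close> are orthogonal to \<open>monic_laguerre \<alpha> n\<close>. The case
  \<open>degree q < n\<close> gives orthogonality; \<open>q = monic_laguerre \<alpha> n\<close> gives the norm.
\<close>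

lemma laguerre_inner_monic_laguerre_poly:
  assumes "\<alpha> > -1" and "degree q \<le> n"
  shows "laguerre_inner \<alpha> (monic_laguerre \<alpha> n) q
       = coeff q n * Gamma (\<alpha> + 1) * pochhammer (\<alpha> + 1) n * fact n"
proof -
  have "q = (\<Sum>j\<le>n. smult (coeff q j) (monom 1 j))"
    using poly_as_sum_of_monoms'[OF assms(2)] by (simp add: smult_monom)
  then have "laguerre_inner \<alpha> (monic_laguerre \<alpha> n) q
      = (\<Sum>j\<le>n. coeff q j * laguerre_inner \<alpha> (monom 1 j) (monic_laguerre \<alpha> n))"
    using laguerre_inner_sum[OF assms(1)] laguerre_inner_commute by metis
  also have "\<dots> = (\<Sum>j\<le>n. if j = n
      then coeff q n * Gamma (\<alpha> + 1) * pochhammer (\<alpha> + 1) n * fact n else 0)"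
    by (intro sum.cong)
      (auto simp: laguerre_inner_commute[of _ "monom 1 _"]
        laguerre_inner_monic_laguerre_monom[OF assms(1)])
  finally show ?thesis
    by simp
qed

theorem mainTheorem1:
  fixes \<alpha> :: real and n :: nat
  assumes "\<alpha> > -1"
  shows "laguerre_gram_schmidt \<alpha> n = smult ((-1) ^ n * fact n) (laguerre_poly n \<alpha>)"
proof -
  have orth_less: "laguerre_inner \<alpha> (monic_laguerre \<alpha> i) (monic_laguerre \<alpha> j) = 0"
    if "j < i" for i j
  proof -
    have "degree (monic_laguerre \<alpha> j) < i"
      using degree_monic_laguerre that by (rule le_less_trans)
    then show ?thesis
      by (simp add: laguerre_inner_monic_laguerre_poly[OF assms] coeff_eq_0)
  qed
  have "gram_schmidt_seq (laguerre_inner \<alpha>) (monom 1) n = monic_laguerre \<alpha> n"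
  proof (rule gram_schmidt_seq_eqI)
    fix i j :: nat assume "i \<noteq> j"
    then show "laguerre_inner \<alpha> (monic_laguerre \<alpha> i) (monic_laguerre \<alpha> j) = 0"
      using orth_less laguerre_inner_commute by (metis linorder_neqE_nat)
  next
    fix i
    have pos: "\<alpha> + 1 > 0"
      using assms by simp
    then have "Gamma (\<alpha> + 1) \<noteq> 0" and "pochhammer (\<alpha> + 1) i \<noteq> 0"
      using Gamma_real_pos[of "\<alpha> + 1"] pochhammer_pos[of "\<alpha> + 1" i] by linarith+
    then show "laguerre_inner \<alpha> (monic_laguerre \<alpha> i) (monic_laguerre \<alpha> i) \<noteq> 0"
      using assms
      by (simp add: laguerre_inner_monic_laguerre_poly degree_monic_laguerre
          lead_coeff_monic_laguerre)
  next
    fix k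
    have "coeff (monom 1 k - monic_laguerre \<alpha> k) j = 0" if "j \<ge> k" for j
    proof (cases "j = k")
      case False
      then have "degree (monic_laguerre \<alpha> k) < j"
        using degree_monic_laguerre[of \<alpha> k] that by linarith
      then show ?thesis
        using False by (simp add: coeff_eq_0)
    qed (simp add: lead_coeff_monic_laguerre[OF assms])
    then obtain c where
      "monom 1 k - monic_laguerre \<alpha> k = (\<Sum>i<k. smult (c i) (monic_laguerre \<alpha> i))"
      using monic_sequence_spans[OF degree_monic_laguerre lead_coeff_monic_laguerre[OF assms]]
      by blast
    then show "\<exists>c. monom 1 k = monic_laguerre \<alpha> k + (\<Sum>i<k. smult (c i) (monic_laguerre \<alpha> i))"
      by (metis add.commute diff_add_cancel)
  qed (simp_all add: laguerre_inner_add[OF assms] laguerre_inner_smult)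
  then show ?thesis
    by (simp add: laguerre_gram_schmidt_def monic_laguerre_def)
qed

end
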